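(* Let $(X,\tau,\mathcal{P})$ be a primal topological space. Then the family $\mathcal{B}=\{T\cap P : T\in\tau_{\delta},\ P\subseteq X,\ P\notin \mathcal{P}\}$ is a base for the topology $\tau^{\diamond}_R$ on $X$.
   Context: A primal on a nonempty set $X$ is a collection $\mathcal{P}\subseteq 2^X$ such that: $X\notin\mathcal{P}$; if $A\in\mathcal{P}$ and $B\subseteq A$, then $B\in\mathcal{P}$; if $A\cap B\in\mathcal{P}$, then $A\in\mathcal{P}$ or $B\in\mathcal{P}$. (The empty collection is allowed.) A primal topological space $(X,\tau,\mathcal{P})$ is a topological space $(X,\tau)$ with a primal $\mathcal{P}$ on $X$. $A^c$ denotes $X\setminus A$. A set $U\subseteq X$ is regular open if $U=int(cl(U))$; $RO(X,x)$ is the family of regular open sets containing the point $x$. A set is $\delta$-open if it equals the union of all regular open sets contained in it; $\tau_\delta$ is the family of all $\delta$-open sets of $(X,\tau)$. For $A\subseteq X$, $A^{\diamond}_R=\{x\in X : A^c\cup U^c\in\mathcal{P}\text{ for all }U\in RO(X,x)\}$ and $cl^{\diamond}_R(A)=A\cup A^{\diamond}_R$. The family $\tau^{\diamond}_R=\{A\subseteq X: cl^{\diamond}_R(A^c)=A^c\}$ is a topology on $X$. *)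

theory Defs
  imports "HOL-Analysis.Abstract_Topology"
begin

definition primal_on :: "'a set \<Rightarrow> 'a set set \<Rightarrow> bool" where
  "primal_on S \<P> \<longleftrightarrow>
     S \<noteq> {} \<and> \<P> \<subseteq> Pow S \<and> S \<notin> \<P> \<and>
     (\<forall>A B. A \<in> \<P> \<longrightarrow> B \<subseteq> A \<longrightarrow> B \<in> \<P>) \<and>
     (\<forall>A B. A \<subseteq> S \<longrightarrow> B \<subseteq> S \<longrightarrow> A \<inter> B \<in> \<P> \<longrightarrow> A \<in> \<P> \<or> B \<in> \<P>)"

definition regular_openin :: "'a topology \<Rightarrow> 'a set \<Rightarrow> bool" where
  "regular_openin X U \<longleftrightarrow> U = X interior_of (X closure_of U)"

definition delta_openin :: "'a topology \<Rightarrow> 'a set \<Rightarrow> bool" where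
  "delta_openin X T \<longleftrightarrow> T = \<Union>{U. regular_openin X U \<and> U \<subseteq> T}"

definition diamond_set :: "'a topology \<Rightarrow> 'a set set \<Rightarrow> 'a set \<Rightarrow> 'a set" where
  "diamond_set X \<P> A =
     {x \<in> topspace X. \<forall>U. regular_openin X U \<and> x \<in> U \<longrightarrow>
        (topspace X - A) \<union> (topspace X - U) \<in> \<P>}"

definition diamond_closure :: "'a topology \<Rightarrow> 'a set set \<Rightarrow> 'a set \<Rightarrow> 'a set" where
  "diamond_closure X \<P> A = A \<union> diamond_set X \<P> A"

definition diamond_open :: "'a topology \<Rightarrow> 'a set set \<Rightarrow> 'a set \<Rightarrow> bool" where
  "diamond_open X \<P> A \<longleftrightarrow>
     A \<subseteq> topspace X \<and> diamond_closure X \<P> (topspace X - A) = topspace X - A"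

text \<open>
  The constructor \<^const>\<open>topology\<close> is meaningful only on families satisfying
  \<^const>\<open>istopology\<close>; \<open>istopology_diamond_open\<close> and \<open>openin_diamond_topology\<close> below
  show that this is the case here for every primal.
\<close>

definition diamond_topology :: "'a topology \<Rightarrow> 'a set set \<Rightarrow> 'a topology" where
  "diamond_topology X \<P> = topology (diamond_open X \<P>)"

definition topology_base :: "'a topology \<Rightarrow> 'a set set \<Rightarrow> bool" where
  "topology_base X \<B> \<longleftrightarrow>
     (\<forall>B\<in>\<B>. openin X B) \<and> (\<forall>U. openin X U \<longrightarrow> (\<exists>\<C>\<subseteq>\<B>. U = \<Union>\<C>))"

lemma regular_openin_imp_openin: "regular_openin X U \<Longrightarrow> openin X U"
  unfolding regular_openin_def by (metis openin_interior_of)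

lemma regular_openin_topspace: "regular_openin X (topspace X)"
  by (simp add: regular_openin_def)

lemma regular_openin_Int:
  assumes "regular_openin X U" "regular_openin X V"
  shows "regular_openin X (U \<inter> V)"
proof -
  have op: "openin X (U \<inter> V)"
    using assms by (intro openin_Int regular_openin_imp_openin)
  have "U \<inter> V \<subseteq> X interior_of (X closure_of (U \<inter> V))"
    by (intro interior_of_maximal closure_of_subset openin_subset op)
  moreover have "X interior_of (X closure_of (U \<inter> V)) \<subseteq> X interior_of (X closure_of U)"
    and "X interior_of (X closure_of (U \<inter> V)) \<subseteq> X interior_of (X closure_of V)"
    by (intro interior_of_mono closure_of_mono; simp)+
  then have "X interior_of (X closure_of (U \<inter> V)) \<subseteq> U \<inter> V"
    by (simp flip: assms[unfolded regular_openin_def])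
  ultimately show ?thesis
    unfolding regular_openin_def by (rule subset_antisym)
qed

lemma diamond_open_iff:
  "diamond_open X \<P> A \<longleftrightarrow>
     A \<subseteq> topspace X \<and>
     (\<forall>x\<in>A. \<exists>U. regular_openin X U \<and> x \<in> U \<and> A \<union> (topspace X - U) \<notin> \<P>)"
proof (cases "A \<subseteq> topspace X")
  case True
  then have A: "topspace X - (topspace X - A) = A" by blast
  have "diamond_open X \<P> A \<longleftrightarrow> diamond_set X \<P> (topspace X - A) \<subseteq> topspace X - A"
    using True unfolding diamond_open_def diamond_closure_def by blast
  also have "\<dots> \<longleftrightarrow> (\<forall>x\<in>A. x \<notin> diamond_set X \<P> (topspace X - A))"
    using True unfolding diamond_set_def by blast
  also have "\<dots> \<longleftrightarrow> (\<forall>x\<in>A. \<exists>U. regular_openin X U \<and> x \<in> U \<and> A \<union> (topspace X - U) \<notin> \<P>)"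
    using True unfolding diamond_set_def A by blast
  finally show ?thesis using True by blast
qed (simp add: diamond_open_def)

lemma istopology_diamond_open:
  assumes "primal_on (topspace X) \<P>"
  shows "istopology (diamond_open X \<P>)"
  unfolding istopology_def
proof (intro conjI allI impI)
  have down: "\<And>A B. B \<notin> \<P> \<Longrightarrow> B \<subseteq> A \<Longrightarrow> A \<notin> \<P>"
    and int: "\<And>A B. A \<subseteq> topspace X \<Longrightarrow> B \<subseteq> topspace X \<Longrightarrow> A \<notin> \<P> \<Longrightarrow> B \<notin> \<P> \<Longrightarrow> A \<inter> B \<notin> \<P>"
    using assms unfolding primal_on_def by blast+
  fix A B assume A: "diamond_open X \<P> A" and B: "diamond_open X \<P> B"
  show "diamond_open X \<P> (A \<inter> B)"
    unfolding diamond_open_iff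
  proof (intro conjI ballI)
    show "A \<inter> B \<subseteq> topspace X" using A by (auto simp: diamond_open_iff)
    fix x assume x: "x \<in> A \<inter> B"
    obtain U where U: "regular_openin X U" "x \<in> U" "A \<union> (topspace X - U) \<notin> \<P>"
      using A x unfolding diamond_open_iff by blast
    obtain V where V: "regular_openin X V" "x \<in> V" "B \<union> (topspace X - V) \<notin> \<P>"
      using B x unfolding diamond_open_iff by blast
    have "(A \<union> (topspace X - U)) \<inter> (B \<union> (topspace X - V)) \<notin> \<P>"
      using A B U(3) V(3) by (intro int) (auto simp: diamond_open_iff)
    then have "A \<inter> B \<union> (topspace X - U \<inter> V) \<notin> \<P>"
      by (rule down) blast
    then show "\<exists>W. regular_openin X W \<and> x \<in> W \<and> A \<inter> B \<union> (topspace X - W) \<notin> \<P>"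
      using regular_openin_Int[OF U(1) V(1)] U(2) V(2) by blast
  qed
next
  have down: "\<And>A B. B \<notin> \<P> \<Longrightarrow> B \<subseteq> A \<Longrightarrow> A \<notin> \<P>"
    using assms unfolding primal_on_def by blast
  fix \<K> assume K: "\<forall>A\<in>\<K>. diamond_open X \<P> A"
  show "diamond_open X \<P> (\<Union>\<K>)"
    unfolding diamond_open_iff
  proof (intro conjI ballI)
    show "\<Union>\<K> \<subseteq> topspace X" using K by (auto simp: diamond_open_iff)
    fix x assume "x \<in> \<Union>\<K>"
    then obtain A where A: "A \<in> \<K>" "x \<in> A" by blast
    then obtain U where U: "regular_openin X U" "x \<in> U" "A \<union> (topspace X - U) \<notin> \<P>"
      using K unfolding diamond_open_iff by blast
    have "\<Union>\<K> \<union> (topspace X - U) \<notin> \<P>"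
      using U(3) by (rule down) (use A in blast)
    then show "\<exists>U. regular_openin X U \<and> x \<in> U \<and> \<Union>\<K> \<union> (topspace X - U) \<notin> \<P>"
      using U by blast
  qed
qed

lemma openin_diamond_topology:
  assumes "primal_on (topspace X) \<P>"
  shows "openin (diamond_topology X \<P>) A \<longleftrightarrow> diamond_open X \<P> A"
  unfolding diamond_topology_def
  by (simp add: topology_inverse'[OF istopology_diamond_open[OF assms]])

lemma topspace_diamond_topology:
  assumes "primal_on (topspace X) \<P>"
  shows "topspace (diamond_topology X \<P>) = topspace X"
proof (rule subset_antisym)
  show "topspace (diamond_topology X \<P>) \<subseteq> topspace X"
    using openin_topspace[of "diamond_topology X \<P>"]
    unfolding openin_diamond_topology[OF assms] diamond_open_def by blast
  have "topspace X \<union> (topspace X - topspace X) \<notin> \<P>"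
    using assms by (simp add: primal_on_def)
  then have "diamond_open X \<P> (topspace X)"
    unfolding diamond_open_iff using regular_openin_topspace by blast
  then show "topspace X \<subseteq> topspace (diamond_topology X \<P>)"
    by (intro openin_subset) (simp only: openin_diamond_topology[OF assms])
qed

end

theory Submission
  imports Defs
begin

text \<open>By \<open>diamond_open_iff\<close>, \<open>A\<close> is open in the new topology iff
  each of its points has a regular open neighbourhood \<open>U\<close> with A \<union> U^c \<notin>
  \<P>. Sets outside a primal are closed under supersets, so enlarging \<open>P\<close> to (T
  \<inter> P) \<union> U^c, where \<open>U\<close> is regular open inside \<open>T\<close>, keeps it
  outside \<P>; hence T \<inter> P is open (\<open>diamond_open_delta_openin_Int\<close>).
  Conversely, if \<open>U\<close> witnesses openness of \<open>A\<close> at \<open>x\<close>, then U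
  \<inter> (A \<union> U^c) = U \<inter> A is a basic set between \<open>x\<close> and
  \<open>A\<close> (\<open>diamond_open_contains_delta_openin_Int\<close>). The pointwise criterion
  \<open>topology_baseI\<close> concludes.\<close>

lemma topology_baseI:
  assumes "\<And>B. B \<in> \<B> \<Longrightarrow> openin X B"
    and "\<And>U x. openin X U \<Longrightarrow> x \<in> U \<Longrightarrow> \<exists>B\<in>\<B>. x \<in> B \<and> B \<subseteq> U"
  shows "topology_base X \<B>"
  unfolding topology_base_def
proof (intro conjI ballI allI impI)
  fix U assume "openin X U"
  then have "\<forall>x\<in>U. \<exists>B\<in>\<B>. x \<in> B \<and> B \<subseteq> U" by (intro ballI assms(2))
  then have "U = \<Union>{B \<in> \<B>. B \<subseteq> U}" by auto
  moreover have "{B \<in> \<B>. B \<subseteq> U} \<subseteq> \<B>" by blast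
  ultimately show "\<exists>\<C>\<subseteq>\<B>. U = \<Union>\<C>" by (intro exI conjI)
qed (rule assms(1))

lemma regular_openin_imp_delta_openin: "regular_openin X U \<Longrightarrow> delta_openin X U"
  unfolding delta_openin_def by blast

lemma delta_openin_contains_regular_openin:
  assumes "delta_openin X T" "x \<in> T"
  obtains U where "regular_openin X U" "x \<in> U" "U \<subseteq> T"
  using assms unfolding delta_openin_def by blast

lemma diamond_open_delta_openin_Int:
  assumes \<P>: "primal_on (topspace X) \<P>"
    and T: "delta_openin X T" and P: "P \<subseteq> topspace X" "P \<notin> \<P>"
  shows "diamond_open X \<P> (T \<inter> P)"
  unfolding diamond_open_iff
proof (intro conjI ballI)
  show "T \<inter> P \<subseteq> topspace X" using P(1) by blast
  fix x assume "x \<in> T \<inter> P"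
  then obtain U where U: "regular_openin X U" "x \<in> U" "U \<subseteq> T"
    using delta_openin_contains_regular_openin[OF T] by blast
  \<comment> \<open>Points of \<open>P\<close> in \<open>U\<close> lie in \<open>T\<close>; the
    others lie in the complement of \<open>U\<close>.\<close>
  have "P \<subseteq> T \<inter> P \<union> (topspace X - U)" using U(3) P(1) by blast
  then have "T \<inter> P \<union> (topspace X - U) \<notin> \<P>"
    using \<P> P(2) unfolding primal_on_def by blast
  then show "\<exists>U. regular_openin X U \<and> x \<in> U \<and> T \<inter> P \<union> (topspace X - U) \<notin> \<P>"
    using U by blast
qed

lemma diamond_open_contains_delta_openin_Int:
  assumes A: "diamond_open X \<P> A" and x: "x \<in> A"
  obtains T P where "delta_openin X T" "P \<subseteq> topspace X" "P \<notin> \<P>" "x \<in> T \<inter> P" "T \<inter> P \<subseteq> A"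
proof -
  obtain U where U: "regular_openin X U" "x \<in> U" "A \<union> (topspace X - U) \<notin> \<P>"
    using A x unfolding diamond_open_iff by blast
  show thesis
  \<comment> \<open>The set outside \<P> that witnesses openness at \<open>x\<close> serves itself
    as the second factor: intersecting it with \<open>U\<close> cancels the complement of
    \<open>U\<close>.\<close>
  proof (rule that[of U "A \<union> (topspace X - U)"])
    show "delta_openin X U" using U(1) by (rule regular_openin_imp_delta_openin)
    show "A \<union> (topspace X - U) \<subseteq> topspace X" using A by (auto simp: diamond_open_iff)
  qed (use U x in blast)+
qed

theorem theorem4p5:
  fixes X :: "'a topology" and \<P> :: "'a set set"
  assumes "primal_on (topspace X) \<P>"
  shows "topology_base (diamond_topology X \<P>)
           {T \<inter> P | T P. delta_openin X T \<and> P \<subseteq> topspace X \<and> P \<notin> \<P>}"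
    (is "topology_base _ ?\<B>")
\<comment> \<open>Primality makes the \<open>diamond_open\<close> sets a topology, so
  \<open>openin\<close> can be replaced by \<open>diamond_open\<close> in both goals.\<close>
proof (rule topology_baseI, unfold openin_diamond_topology[OF assms])
  fix B assume "B \<in> ?\<B>"
  then obtain T P where B: "B = T \<inter> P" and TP: "delta_openin X T" "P \<subseteq> topspace X" "P \<notin> \<P>"
    by (elim CollectE exE conjE)
  show "diamond_open X \<P> B"
    unfolding B by (rule diamond_open_delta_openin_Int[OF assms TP])
next
  fix A x assume "diamond_open X \<P> A" "x \<in> A"
  then obtain T P where TP: "delta_openin X T" "P \<subseteq> topspace X" "P \<notin> \<P>"
    and x: "x \<in> T \<inter> P" "T \<inter> P \<subseteq> A"
    by (rule diamond_open_contains_delta_openin_Int)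
  have "T \<inter> P \<in> ?\<B>" using TP by blast
  with conjI[OF x] show "\<exists>B\<in>?\<B>. x \<in> B \<and> B \<subseteq> A" by (rule bexI)
qed

end
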